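(* For every nonnegative integer $n$, let $r_F(n)$ be the number of ways to write $n$ as a sum of distinct Fibonacci numbers (order of summands irrelevant), and for positive integers $p,N$ let $S_F^{(p)}(N) := \sum_{n=0}^{N-1} (r_F(n))^p$. Let $\varphi := (1+\sqrt5)/2$. For each positive integer $p$, let $\lambda_p > 1$ be the real number such that $S_F^{(p)}(N) \asymp_p N^{(\log \lambda_p)/\log\varphi}$ as $N \to +\infty$. Then \[ \lim_{p\to+\infty} \lambda_p^{1/p} = \varphi^{1/2}. \]
   Context: The Fibonacci numbers here are $f_1 = 1$, $f_2 = 2$, $f_{n+2} = f_{n+1} + f_n$ (summands are the distinct values $1,2,3,5,8,\dots$); $r_F(0)=1$. The notation $f(N) \asymp_p g(N)$ means $0 < \liminf f(N)/g(N) \le \limsup f(N)/g(N) < +\infty$ as $N\to\infty$, with bounds possibly depending on $p$. For each $p$, such a $\lambda_p>1$ exists and is uniquely determined by this asymptotic relation. *)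

theory Defs
  imports Complex_Main "HOL-Library.Extended_Real" "HOL-Number_Theory.Fib"
begin

(* Shifting the index by one drops the duplicate fib 1 = fib 2 = 1 and the value
   fib 0 = 0, so f 1 = 1, f 2 = 2, f 3 = 3, f 4 = 5, ... with f n = fib (n + 1). *)
definition fibonacci_numbers :: "nat set" where
  "fibonacci_numbers = {fib (n + 1) | n. n \<ge> 1}"

definition r_F :: "nat \<Rightarrow> nat" where
  "r_F n = card {A. finite A \<and> A \<subseteq> fibonacci_numbers \<and> \<Sum>A = n}"

(* The collection counted by r_F is finite, so card is the true number of its members. *)
lemma finite_fibonacci_representations:
  "finite {A. finite A \<and> A \<subseteq> fibonacci_numbers \<and> \<Sum>A = n}"
proof (rule finite_subset)
  show "{A. finite A \<and> A \<subseteq> fibonacci_numbers \<and> \<Sum>A = n} \<subseteq> Pow {..n}"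
    using member_le_sum[where f = "\<lambda>x::nat. x"] by fastforce
qed simp

lemma r_F_0: "r_F 0 = 1"
proof -
  have "fib (n + 1) \<noteq> 0" for n
    using fib_neq_0_nat[of "n + 1"] by simp
  then have "0 \<notin> fibonacci_numbers"
    unfolding fibonacci_numbers_def mem_Collect_eq by metis
  then have "{A. finite A \<and> A \<subseteq> fibonacci_numbers \<and> \<Sum>A = 0} = {{}}"
    by (auto simp: subset_iff) metis
  then show ?thesis
    by (simp add: r_F_def)
qed

definition S_F :: "nat \<Rightarrow> nat \<Rightarrow> nat" where
  "S_F p N = (\<Sum>n<N. r_F n ^ p)"

definition golden_ratio :: real where
  "golden_ratio = (1 + sqrt 5) / 2"

(* Meaningful when g is eventually nonzero, since x / 0 = 0 in HOL. *)
definition same_order :: "(nat \<Rightarrow> real) \<Rightarrow> (nat \<Rightarrow> real) \<Rightarrow> bool" where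
  "same_order f g \<longleftrightarrow>
     0 < liminf (\<lambda>N. ereal (f N / g N)) \<and>
     liminf (\<lambda>N. ereal (f N / g N)) \<le> limsup (\<lambda>N. ereal (f N / g N)) \<and>
     limsup (\<lambda>N. ereal (f N / g N)) < \<infinity>"

end

theory Submission
  imports Defs
begin

text \<open>
  Put \<open>s n = r_F (n - 1)\<close> and \<open>s 0 = 0\<close>. Splitting the representations according to whether they
  use the largest possible summand, and complementing those that do not, gives the Stern-like
  recurrence \<open>s (F j + a) = s a + s (F (j - 1) - a)\<close> for \<open>a \<le> F (j - 1)\<close>. It implies
  \<open>s n \<le> \<phi> powr (k / 2)\<close> for \<open>n \<le> F k\<close>, because \<open>x = \<phi> powr (1 / 2)\<close> satisfies
  \<open>x\<^sup>4 = x\<^sup>2 + 1\<close> and \<open>2 \<le> x\<^sup>3\<close>; and it gives \<open>s (F i * F (i + 1)) = F i\<close>. So the exponent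
  \<open>e = ln \<lambda> / ln \<phi>\<close> of the moment of order \<open>p\<close> lies between \<open>p / 2\<close> and \<open>1 + p / 2\<close>.
\<close>

section \<open>Representations as sums of Fibonacci numbers\<close>

text \<open>Index sets replace sets of values. Indices start at 2 because \<open>fib\<close> is
  injective only from there on; the cap \<open>k\<close> makes recursion on the largest index and
  complementation possible.\<close>

definition fib_reps :: "nat \<Rightarrow> nat \<Rightarrow> nat set set" where
  "fib_reps k n = {I. I \<subseteq> {2..k} \<and> sum fib I = n}"

lemma finite_fib_reps [simp]: "finite (fib_reps k n)"
  by (rule finite_subset[of _ "Pow {2..k}"]) (auto simp: fib_reps_def)

lemma inj_on_fib: "inj_on fib {2..}"
proof (rule linorder_inj_onI)
  fix x y :: nat assume "x < y" and "x \<in> {2..}" "y \<in> {2..}"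
  then obtain m where "x = m + 2" by (metis atLeast_iff le_Suc_ex add.commute)
  then have "fib x < fib (Suc x)" by (simp add: fib_neq_0_nat)
  also have "\<dots> \<le> fib y" using \<open>x < y\<close> by (intro fib_mono) simp
  finally show "fib x \<noteq> fib y" by simp
qed auto

lemma fibonacci_numbers_eq: "fibonacci_numbers = fib ` {2..}"
proof -
  have "{2..} = (\<lambda>n. n + 1) ` {1::nat..}"
    using image_add_atLeast[of 1 "1::nat"] by (simp add: add.commute numeral_2_eq_2)
  moreover have "fibonacci_numbers = (\<lambda>n. fib (n + 1)) ` {1..}"
    by (auto simp: fibonacci_numbers_def)
  ultimately show ?thesis
    by (simp only: image_image)
qed

text \<open>An index above \<open>k\<close> would already contribute more than \<open>n\<close>, so
  the cap loses nothing; injectivity of \<open>fib\<close> from 2 on identifies index sets with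
  their images.\<close>

lemma r_F_eq_card_fib_reps:
  assumes "n < fib (Suc k)"
  shows "r_F n = card (fib_reps k n)"
proof -
  have "bij_betw ((`) fib) (fib_reps k n) {A. finite A \<and> A \<subseteq> fibonacci_numbers \<and> \<Sum>A = n}"
    unfolding bij_betw_def
  proof
    show "inj_on ((`) fib) (fib_reps k n)"
      by (rule inj_on_subset[OF inj_on_image_Pow[OF inj_on_fib]]) (auto simp: fib_reps_def)
    have sum_image: "\<Sum>(fib ` I) = sum fib I" if "I \<subseteq> {2..}" for I
      using sum.reindex[OF inj_on_subset[OF inj_on_fib that], of "\<lambda>x. x"] by simp
    show "(`) fib ` fib_reps k n = {A. finite A \<and> A \<subseteq> fibonacci_numbers \<and> \<Sum>A = n}"
    proof (intro equalityI subsetI)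
      fix A assume "A \<in> (`) fib ` fib_reps k n"
      then obtain I where I: "I \<subseteq> {2..k}" "sum fib I = n" "A = fib ` I"
        by (auto simp: fib_reps_def)
      then have "I \<subseteq> {2..}" "finite I" by (auto intro: finite_subset)
      then show "A \<in> {A. finite A \<and> A \<subseteq> fibonacci_numbers \<and> \<Sum>A = n}"
        using I sum_image by (auto simp: fibonacci_numbers_eq)
    next
      fix A assume A: "A \<in> {A. finite A \<and> A \<subseteq> fibonacci_numbers \<and> \<Sum>A = n}"
      then obtain I where I: "I \<subseteq> {2..}" "A = fib ` I"
        unfolding fibonacci_numbers_eq by (auto simp: subset_image_iff)
      have "finite I"
        using A I finite_imageD inj_on_subset[OF inj_on_fib I(1)] by auto
      moreover have sum: "sum fib I = n" using A I sum_image by auto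
      ultimately have "i \<le> k" if "i \<in> I" for i
        using member_le_sum[of i I fib] that assms fib_mono[of "Suc k" i]
        by (cases "i \<le> k") auto
      then have "I \<in> fib_reps k n" using I sum by (auto simp: fib_reps_def)
      then show "A \<in> (`) fib ` fib_reps k n" using I by auto
    qed
  qed
  then show ?thesis
    unfolding r_F_def by (metis bij_betw_same_card)
qed

lemma card_fib_reps_Suc:
  assumes "k \<ge> 1"
  shows "card (fib_reps (Suc k) n) = card (fib_reps k n) +
    (if fib (Suc k) \<le> n then card (fib_reps k (n - fib (Suc k))) else 0)"
proof -
  let ?U = "{I \<in> fib_reps (Suc k) n. Suc k \<in> I}"
  have interval: "{2..Suc k} = insert (Suc k) {2..k}" using assms by auto
  have notin: "Suc k \<notin> I" "finite I" if "I \<subseteq> {2..k}" for I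
    using that by (auto intro: finite_subset)
  have "fib_reps (Suc k) n = fib_reps k n \<union> ?U"
    by (auto simp: fib_reps_def interval)
  moreover have "fib_reps k n \<inter> ?U = {}" by (auto simp: fib_reps_def)
  moreover have "finite ?U" by simp
  ultimately have "card (fib_reps (Suc k) n) = card (fib_reps k n) + card ?U"
    by (metis card_Un_disjoint finite_fib_reps)
  moreover have "card ?U = (if fib (Suc k) \<le> n then card (fib_reps k (n - fib (Suc k))) else 0)"
  proof (cases "fib (Suc k) \<le> n")
    case True
    \<comment> \<open>Deleting the index \<open>Suc k\<close> is inverse to inserting it, and lowers
      the sum by \<open>fib (Suc k)\<close>.\<close>
    have "bij_betw (insert (Suc k)) (fib_reps k (n - fib (Suc k))) ?U"
    proof (rule bij_betw_byWitness[where f' = "\<lambda>I. I - {Suc k}"])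
      show "\<forall>I\<in>fib_reps k (n - fib (Suc k)). insert (Suc k) I - {Suc k} = I"
        using notin by (simp add: fib_reps_def)
      show "\<forall>I\<in>?U. insert (Suc k) (I - {Suc k}) = I"
        by blast
      show "insert (Suc k) ` fib_reps k (n - fib (Suc k)) \<subseteq> ?U"
      proof clarify
        fix I assume I: "I \<in> fib_reps k (n - fib (Suc k))"
        then have subset: "I \<subseteq> {2..k}" and sum: "sum fib I = n - fib (Suc k)"
          by (simp_all add: fib_reps_def)
        have "sum fib (insert (Suc k) I) = n"
          using notin[OF subset] sum True by (simp del: fib.simps)
        with subset show "insert (Suc k) I \<in> fib_reps (Suc k) n \<and> Suc k \<in> insert (Suc k) I"
          unfolding fib_reps_def interval by blast
      qed
      show "(\<lambda>I. I - {Suc k}) ` ?U \<subseteq> fib_reps k (n - fib (Suc k))"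
      proof clarify
        fix I assume I: "I \<in> fib_reps (Suc k) n" "Suc k \<in> I"
        then have "I - {Suc k} \<subseteq> {2..k}" and sum: "sum fib I = n"
          unfolding fib_reps_def interval by auto
        moreover have "sum fib (I - {Suc k}) = n - fib (Suc k)"
          using I(2) sum by (simp only: sum_diff1_nat if_True)
        ultimately show "I - {Suc k} \<in> fib_reps k (n - fib (Suc k))"
          unfolding fib_reps_def by blast
      qed
    qed
    then show ?thesis using True by (simp add: bij_betw_same_card)
  next
    case False
    have "fib (Suc k) \<le> n" if "I \<in> ?U" for I
    proof -
      have "finite I" using that by (auto simp: fib_reps_def intro: finite_subset)
      then show ?thesis
        using that member_le_sum[of "Suc k" I fib] by (auto simp: fib_reps_def)
    qed
    then have "?U = {}" using False by blast
    then show ?thesis using False by (simp only: card.empty if_False)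
  qed
  ultimately show ?thesis by simp
qed

lemma sum_fib_from_2:
  assumes "k \<ge> 1"
  shows "sum fib {2..k} + 2 = fib (k + 2)"
  using assms
proof (induction k rule: dec_induct)
  case (step k)
  then have "{2..Suc k} = insert (Suc k) {2..k}" by auto
  then show ?case using step.IH by simp
qed (simp add: numeral_2_eq_2)

text \<open>Complementing an index set inside \<open>{2..k}\<close> is an involution that exchanges
  the sums \<open>n\<close> and \<open>m\<close>.\<close>

lemma card_fib_reps_complement:
  assumes "n + m = sum fib {2..k}"
  shows "card (fib_reps k n) = card (fib_reps k m)"
proof -
  have flip: "{2..k} - I \<in> fib_reps k m" if "I \<in> fib_reps k n" "n + m = sum fib {2..k}" for I n m
    using that sum.subset_diff[of I "{2..k}" fib] by (auto simp: fib_reps_def)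
  have "bij_betw (\<lambda>I. {2..k} - I) (fib_reps k n) (fib_reps k m)"
    by (rule bij_betw_byWitness[where f' = "\<lambda>I. {2..k} - I"])
      (use flip assms in \<open>auto simp: add.commute fib_reps_def\<close>)
  then show ?thesis by (rule bij_betw_same_card)
qed

lemma fib_reps_eq_empty:
  assumes "n > sum fib {2..k}"
  shows "fib_reps k n = {}"
proof -
  have False if "I \<in> fib_reps k n" for I
  proof -
    have "I \<subseteq> {2..k}" and sum: "sum fib I = n"
      using that unfolding fib_reps_def by auto
    then have "sum fib I \<le> sum fib {2..k}" by (intro sum_mono2) auto
    then show False using assms sum by linarith
  qed
  then show ?thesis by blast
qed

section \<open>The shifted counting function\<close>

text \<open>The total over \<open>{2..k}\<close> is \<open>fib (k + 2) - 2\<close>. After a shift by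
  one, complementation becomes the reflection of \<open>x\<close> to \<open>fib (k + 2) - x\<close>,
  and the value 0 at 0 absorbs the boundary cases.\<close>

definition shifted_r_F :: "nat \<Rightarrow> nat" where
  "shifted_r_F n = (if n = 0 then 0 else r_F (n - 1))"

lemma shifted_r_F_0 [simp]: "shifted_r_F 0 = 0"
  and shifted_r_F_1 [simp]: "shifted_r_F (Suc 0) = 1"
  by (simp_all add: shifted_r_F_def r_F_0)

lemma shifted_r_F_rec:
  assumes "a \<le> fib (Suc k)"
  shows "shifted_r_F (fib (k + 2) + a) = shifted_r_F a + shifted_r_F (fib (Suc k) - a)"
proof -
  define n where "n = fib (k + 2) + a - 1"
  have pos: "fib (Suc k) > 0" "fib (k + 2) > 0" by (simp_all add: fib_neq_0_nat)
  have step: "fib (Suc (k + 2)) = fib (k + 2) + fib (Suc k)" by simp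
  have total: "sum fib {2..Suc k} + 2 = fib (k + 2) + fib (Suc k)"
    using sum_fib_from_2[of "Suc k"] by simp
  have "r_F n = card (fib_reps (k + 2) n)"
    using assms pos step by (intro r_F_eq_card_fib_reps) (simp add: n_def)
  also have "\<dots> = card (fib_reps (Suc k) n) +
      (if fib (k + 2) \<le> n then card (fib_reps (Suc k) (n - fib (k + 2))) else 0)"
    using card_fib_reps_Suc[of "Suc k" n] by simp
  also have "(if fib (k + 2) \<le> n then card (fib_reps (Suc k) (n - fib (k + 2))) else 0)
      = shifted_r_F a"
  \<comment> \<open>For \<open>a = 0\<close> the number \<open>n\<close> is just below
    \<open>fib (k + 2)\<close>, so the top index cannot occur. Otherwise removing it leaves
    \<open>a - 1\<close>.\<close>
  proof (cases "a = 0")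
    case True
    then show ?thesis using pos by (simp add: n_def)
  next
    case False
    then have "n - fib (k + 2) = a - 1" "fib (k + 2) \<le> n" by (auto simp: n_def)
    moreover have "a - 1 < fib (Suc (Suc k))" using assms False by simp
    ultimately show ?thesis
      using False r_F_eq_card_fib_reps[of "a - 1" "Suc k"] by (simp add: shifted_r_F_def)
  qed
  also have "card (fib_reps (Suc k) n) = shifted_r_F (fib (Suc k) - a)"
  proof (cases "a = fib (Suc k)")
    \<comment> \<open>Here \<open>n\<close> exceeds the total over \<open>{2..Suc k}\<close> by
      exactly one, so nothing represents it, in accordance with the value 0 at 0.\<close>
    case True
    then show ?thesis
      using total fib_reps_eq_empty[of "Suc k" n] pos by (simp add: n_def)
  next
    case False
    then have "n + (fib (Suc k) - a - 1) = sum fib {2..Suc k}"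
      using total assms pos unfolding n_def by linarith
    moreover have "fib (Suc k) - a - 1 < fib (Suc (Suc k))" using pos by simp
    ultimately show ?thesis
      using False assms card_fib_reps_complement r_F_eq_card_fib_reps[of _ "Suc k"]
      by (simp add: shifted_r_F_def)
  qed
  finally show ?thesis using pos by (simp add: shifted_r_F_def n_def)
qed

section \<open>The growth of the counting function\<close>

lemma golden_ratio_gt_1: "golden_ratio > 1"
  and golden_ratio_square: "golden_ratio ^ 2 = golden_ratio + 1"
  by (simp_all add: golden_ratio_def power2_eq_square field_simps)

lemma golden_ratio_powr_add_2:
  "golden_ratio powr (x + 2) = golden_ratio powr (x + 1) + golden_ratio powr x"
proof -
  have "golden_ratio powr (x + 2) = golden_ratio powr x * golden_ratio ^ 2"
    using golden_ratio_gt_1 by (simp add: powr_add)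
  also have "\<dots> = golden_ratio powr (x + 1) + golden_ratio powr x"
    using golden_ratio_gt_1 by (simp add: golden_ratio_square powr_add algebra_simps)
  finally show ?thesis .
qed

text \<open>The square of the right side is \<phi> cubed, that is 2\<phi> + 1, which is at least 4.
  This pays for the factor 2 when both summands of the recurrence are small.\<close>

lemma two_le_golden_ratio_powr: "2 \<le> golden_ratio powr (3 / 2)"
proof -
  have "golden_ratio ^ 3 = 2 * golden_ratio + 1"
    using golden_ratio_square by (simp add: power3_eq_cube power2_eq_square algebra_simps)
  moreover have "golden_ratio \<ge> 3 / 2"
    by (simp add: golden_ratio_def real_le_rsqrt)
  moreover have "(golden_ratio powr (3 / 2)) ^ 2 = golden_ratio ^ 3"
    using golden_ratio_gt_1 by (simp add: powr_power)
  ultimately have "2 ^ 2 \<le> (golden_ratio powr (3 / 2)) ^ 2" by simp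
  then show ?thesis by (rule power2_le_imp_le) simp
qed

lemma fib_le_golden_ratio_powr: "real (fib k) \<le> golden_ratio powr k"
proof (induction k rule: fib.induct)
  case (3 k)
  then show ?case
    using golden_ratio_powr_add_2[of k] by (simp add: algebra_simps)
qed (use golden_ratio_gt_1 in auto)

lemma golden_ratio_powr_le_fib:
  assumes "k \<ge> 1"
  shows "golden_ratio powr (real k - 2) \<le> real (fib k)"
proof -
  \<comment> \<open>The shifted index makes the two base cases \<open>fib 1\<close> and
    \<open>fib 2\<close>, avoiding \<open>fib 0 = 0\<close>, for which the bound fails.\<close>
  have "golden_ratio powr (real k - 1) \<le> real (fib (Suc k))" for k
  proof (induction k rule: fib.induct)
    case 1
    then show ?case using golden_ratio_gt_1 by (simp add: powr_minus field_simps)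
  next
    case 2
    then show ?case by simp
  next
    case (3 k)
    then show ?case
      using golden_ratio_powr_add_2[of "real k - 1"] by (simp add: algebra_simps)
  qed
  from this[of "k - 1"] assms show ?thesis by (simp add: of_nat_diff)
qed

section \<open>The upper bound for the counting function\<close>

lemma shifted_r_F_2: "shifted_r_F 2 = 1"
  using shifted_r_F_rec[of 1 0] by (simp add: numeral_2_eq_2)

lemma shifted_r_F_le: "n \<le> fib k \<Longrightarrow> real (shifted_r_F n) \<le> golden_ratio powr (k / 2)"
proof (induction k arbitrary: n rule: less_induct)
  case (less k)
  have small: ?case if "n \<le> 2"
  proof -
    have "n = 0 \<or> n = 1 \<or> n = 2" using that by linarith
    then have "shifted_r_F n \<le> 1" by (auto simp: shifted_r_F_2)
    moreover have "1 \<le> golden_ratio powr (k / 2)"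
      using golden_ratio_gt_1 by (simp add: ge_one_powr_ge_zero)
    ultimately show ?thesis by (smt (verit) of_nat_le_1_iff)
  qed
  show ?case
  proof (cases "k < 4")
    case True
    then have "fib k \<le> fib 3" by (intro fib_mono) simp
    then show ?thesis using less.prems small by (simp add: eval_nat_numeral)
  next
    case False
    then obtain m where k: "k = m + 4" by (metis add.commute le_Suc_ex not_less)
    have fib4: "fib (m + 4) = fib (m + 3) + fib (m + 2)" "fib (m + 2) = fib (m + 1) + fib m"
      by (simp_all add: eval_nat_numeral)
    show ?thesis
    proof (cases "n \<le> fib (m + 3)")
      case True
      have "real (shifted_r_F n) \<le> golden_ratio powr ((m + 3) / 2)"
        using less.IH[OF _ True] k by simp
      also have "\<dots> \<le> golden_ratio powr (k / 2)"
        using golden_ratio_gt_1 k by (intro powr_mono) auto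
      finally show ?thesis .
    next
      case False
      \<comment> \<open>The recurrence splits the value at \<open>n\<close> into those at
        \<open>a\<close> and \<open>b\<close>, with \<open>a + b = fib (m + 1) + fib m\<close>. So
        either one of them reaches \<open>fib (m + 1)\<close> and the other is at most
        \<open>fib m\<close>, or both are at most \<open>fib (m + 1)\<close>.\<close>
      define a b where "a = n - fib (m + 3)" and "b = fib (m + 2) - a"
      have ab: "n = fib (m + 3) + a" "a + b = fib (m + 2)"
        using False less.prems fib4 k by (simp_all add: a_def b_def)
      have s: "shifted_r_F n = shifted_r_F a + shifted_r_F b"
        using shifted_r_F_rec[of a "m + 1"] ab by (simp add: b_def eval_nat_numeral)
      \<comment> \<open>The bounds at levels \<open>m + 2\<close> and \<open>m\<close> add up
        exactly to the one at \<open>m + 4\<close>, by the Fibonacci recurrence for powers at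
        half-integer exponents.\<close>
      have unbalanced: "shifted_r_F x + shifted_r_F y \<le> golden_ratio powr (k / 2)"
        if "x + y = fib (m + 2)" "x \<ge> fib (m + 1)" for x y
      proof -
        have "real (shifted_r_F x) \<le> golden_ratio powr ((m + 2) / 2)"
          using less.IH[of "m + 2" x] that k by simp
        moreover have "real (shifted_r_F y) \<le> golden_ratio powr (m / 2)"
          using less.IH[of m y] that fib4 k by simp
        ultimately show ?thesis
          using golden_ratio_powr_add_2[of "m / 2"] k by (simp add: add_divide_distrib add.commute)
      qed
      consider "a \<ge> fib (m + 1)" | "b \<ge> fib (m + 1)" | "a \<le> fib (m + 1)" "b \<le> fib (m + 1)"
        by linarith
      then show ?thesis
      proof cases
        case 1
        then show ?thesis using unbalanced[of a b] ab s by simp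
      next
        case 2
        then show ?thesis using unbalanced[of b a] ab s by simp
      next
        case 3
        then have "real (shifted_r_F n) \<le> 2 * golden_ratio powr ((m + 1) / 2)"
          using less.IH[of "m + 1" a] less.IH[of "m + 1" b] s k by simp
        also have "\<dots> \<le> golden_ratio powr (3 / 2) * golden_ratio powr ((m + 1) / 2)"
          by (intro mult_right_mono two_le_golden_ratio_powr) simp
        also have "\<dots> = golden_ratio powr (k / 2)"
          by (simp add: powr_add[symmetric] k field_simps)
        finally show ?thesis .
      qed
    qed
  qed
qed

section \<open>Arguments at which the upper bound has the right order\<close>

lemma fib_double: "fib (2 * i + 2) = fib (Suc i) * (fib i + fib (i + 2))"
proof -
  have "2 * i + 2 = Suc (i + Suc i)" by simp
  then have "fib (2 * i + 2) = fib (Suc (Suc i)) * fib (Suc i) + fib (Suc i) * fib i"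
    by (simp only: fib_add)
  then show ?thesis by (simp add: algebra_simps)
qed

lemma shifted_r_F_fib_mult_fib: "shifted_r_F (fib i * fib (Suc i)) = fib i"
proof (induction i rule: fib.induct)
  case (3 i)
  define a where "a = fib i * fib (Suc i)"
  \<comment> \<open>Two successive products of neighbouring Fibonacci numbers sum to a Fibonacci
    number. The recurrence therefore expresses the value at the next product as the sum of the
    values at the two preceding ones, which is the recurrence of \<open>fib\<close>.\<close>
  have "a + fib (Suc i) * fib (i + 2) = fib (Suc (2 * i + 1))"
    using fib_double[of i] by (simp add: a_def algebra_simps)
  moreover from this have "fib (i + 2) * fib (i + 3) = fib (2 * i + 1 + 2) + a"
    using fib_double[of "Suc i"] by (simp add: a_def eval_nat_numeral algebra_simps)
  ultimately have "shifted_r_F (fib (i + 2) * fib (i + 3)) =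
      shifted_r_F a + shifted_r_F (fib (Suc i) * fib (i + 2))"
    using shifted_r_F_rec[of a "2 * i + 1"] by (metis add_diff_cancel_left' le_add1)
  then show ?case using 3 by (simp add: a_def eval_nat_numeral)
qed simp_all

section \<open>The moments\<close>

lemma S_F_fib_le: "real (S_F p (fib k)) \<le> golden_ratio powr (k * (1 + p / 2))"
proof -
  have "real (r_F n) \<le> golden_ratio powr (k / 2)" if "n < fib k" for n
    using shifted_r_F_le[of "Suc n" k] that by (simp add: shifted_r_F_def)
  then have "real (S_F p (fib k)) \<le> (\<Sum>n<fib k. (golden_ratio powr (k / 2)) ^ p)"
    unfolding S_F_def of_nat_sum of_nat_power by (intro sum_mono power_mono) auto
  also have "\<dots> = fib k * golden_ratio powr (k / 2 * p)"
    using golden_ratio_gt_1 by (simp add: powr_power mult.commute)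
  also have "\<dots> \<le> golden_ratio powr k * golden_ratio powr (k / 2 * p)"
    by (intro mult_right_mono fib_le_golden_ratio_powr) simp
  finally show ?thesis by (simp add: powr_add[symmetric] algebra_simps)
qed

text \<open>The last summand alone, at \<open>n = fib i * fib (Suc i) - 1\<close>, already equals
  the left side.\<close>

lemma fib_power_le_S_F:
  assumes "i \<ge> 1"
  shows "fib i ^ p \<le> S_F p (fib i * fib (Suc i))"
proof -
  define n where "n = fib i * fib (Suc i) - 1"
  have "fib i * fib (Suc i) > 0" using assms by (simp add: fib_neq_0_nat)
  then have "fib i * fib (Suc i) = Suc n" "r_F n = fib i"
    using shifted_r_F_fib_mult_fib[of i] by (auto simp: shifted_r_F_def n_def)
  then show ?thesis unfolding S_F_def by simp
qed

section \<open>Reading exponents off asymptotic bounds\<close>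

lemma exponent_le_if_powr_bound:
  fixes b x y A B :: real
  assumes "b > 1" "A > 0"
    and "eventually (\<lambda>k. A * b powr (real k * x) \<le> B * b powr (real k * y)) sequentially"
  shows "x \<le> y"
proof (rule ccontr)
  assume "\<not> x \<le> y"
  \<comment> \<open>The powers of this number tend to infinity, whereas the assumed inequality
    bounds them eventually by \<open>B / A\<close>.\<close>
  then have "b powr (x - y) > 1" using assms(1) by simp
  then have "filterlim (\<lambda>k. (b powr (x - y)) ^ k) at_infinity sequentially"
    by (intro filterlim_realpow_sequentially_gt1) simp
  then have "filterlim (\<lambda>k. (b powr (x - y)) ^ k) at_top sequentially"
    by (rule filterlim_at_infinity_imp_filterlim_at_top) (use assms(1) in simp)
  then have "eventually (\<lambda>k. (b powr (x - y)) ^ k > B / A) sequentially"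
    by (simp add: filterlim_at_top_dense)
  then have "eventually (\<lambda>_. False) sequentially"
    using assms(3)
  proof eventually_elim
    case (elim k)
    have "(b powr (x - y)) ^ k = b powr (real k * x) / b powr (real k * y)"
      using assms(1) by (simp add: powr_power powr_diff[symmetric] algebra_simps)
    then have "B / A * b powr (real k * y) < b powr (real k * x)"
      using elim(1) assms(1) by (simp only: less_divide_eq) simp
    then show ?case using elim(2) assms(2) by (simp add: field_simps)
  qed
  then show False by simp
qed

lemma same_orderE:
  assumes "same_order f g" and "eventually (\<lambda>N. g N > 0) sequentially"
  obtains c C where "c > 0" "eventually (\<lambda>N. c * g N \<le> f N) sequentially"
    "eventually (\<lambda>N. f N \<le> C * g N) sequentially"
proof -
  \<comment> \<open>Real constants strictly beyond the liminf and the limsup turn them into eventual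
    inequalities, which positivity of \<open>g\<close> lets one multiply out.\<close>
  obtain c where c: "0 < c" "ereal c < liminf (\<lambda>N. ereal (f N / g N))"
    using assms(1) ereal_dense2[of 0] unfolding same_order_def by (metis ereal_less(2))
  obtain C where C: "limsup (\<lambda>N. ereal (f N / g N)) < ereal C"
    using assms(1) ereal_dense2[of _ \<infinity>] unfolding same_order_def by metis
  have "eventually (\<lambda>N. c * g N \<le> f N) sequentially"
    using less_LiminfD[OF c(2)] assms(2)
    by eventually_elim (simp add: field_simps)
  moreover have "eventually (\<lambda>N. f N \<le> C * g N) sequentially"
    using Limsup_lessD[OF C] assms(2)
    by eventually_elim (simp add: field_simps)
  ultimately show ?thesis using that c(1) by blast
qed

lemma filterlim_fib: "filterlim fib at_top sequentially"
proof (rule filterlim_at_top_mono[OF filterlim_minus_const_nat_at_top[of 1]])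
  have "k - 1 \<le> fib k" for k
  proof (induction k rule: fib.induct)
    case (3 k)
    then show ?case using fib_neq_0_nat[of k] by (cases "k = 0") auto
  qed simp_all
  then show "eventually (\<lambda>k. k - 1 \<le> fib k) sequentially" by simp
qed

text \<open>The upper bound comes from \<open>N = fib k\<close>, where all summands are bounded
  uniformly; the lower one from \<open>N = fib i * fib (Suc i)\<close>, where one summand is large.
  Since \<open>e \<ge> 0\<close>, bounds on \<open>N\<close> carry over to
  \<open>N powr e\<close>.\<close>

lemma moment_exponent_bounds:
  assumes "same_order (\<lambda>N. real (S_F p N)) (\<lambda>N. real N powr e)" and "e \<ge> 0"
  shows "p / 2 \<le> e" and "e \<le> 1 + p / 2"
proof -
  have "eventually (\<lambda>N. real N powr e > 0) sequentially"
    using eventually_gt_at_top[of 0] by eventually_elim simp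
  from same_orderE[OF assms(1) this] obtain c C where c: "c > 0"
    and lower: "eventually (\<lambda>N. c * real N powr e \<le> S_F p N) sequentially"
    and upper: "eventually (\<lambda>N. S_F p N \<le> C * real N powr e) sequentially" .
  note g = golden_ratio_gt_1

  \<comment> \<open>The constant with exponent \<open>- 2 * e\<close> is the loss in
    \<open>fib k \<ge> golden_ratio powr (k - 2)\<close>.\<close>
  have "eventually (\<lambda>k. (c * golden_ratio powr (- 2 * e)) * golden_ratio powr (real k * e) \<le>
      1 * golden_ratio powr (real k * (1 + p / 2))) sequentially"
    using eventually_compose_filterlim[OF lower filterlim_fib] eventually_ge_at_top[of 1]
  proof eventually_elim
    case (elim k)
    have "(c * golden_ratio powr (- 2 * e)) * golden_ratio powr (real k * e)
        = c * (golden_ratio powr (real k - 2)) powr e"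
      by (simp add: powr_powr powr_add[symmetric] algebra_simps)
    also have "\<dots> \<le> c * real (fib k) powr e"
      using elim(2) c assms(2) by (intro mult_left_mono powr_mono2 golden_ratio_powr_le_fib) auto
    also have "\<dots> \<le> 1 * golden_ratio powr (real k * (1 + p / 2))"
      using elim(1) S_F_fib_le[of p k] by simp
    finally show ?case .
  qed
  then show "e \<le> 1 + p / 2"
    by (rule exponent_le_if_powr_bound[OF g, rotated]) (use c g in simp)

  have "filterlim (\<lambda>i. fib i * fib (Suc i)) at_top sequentially"
    by (rule filterlim_at_top_mono[OF filterlim_fib])
      (simp add: fib_neq_0_nat Suc_le_eq)
  from eventually_compose_filterlim[OF upper this]
  \<comment> \<open>The product \<open>fib i * fib (Suc i)\<close> is at most \<phi> to the power
    \<open>2 * i + 1\<close>, whence the factor \<open>golden_ratio powr e\<close>. The sign of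
    \<open>C\<close> is not known, and \<open>max 0 C\<close> supplies the nonnegativity that
    monotone multiplication requires.\<close>
  have "eventually (\<lambda>i. golden_ratio powr (- 2 * real p) * golden_ratio powr (real i * p) \<le>
      (max 0 C * golden_ratio powr e) * golden_ratio powr (real i * (2 * e))) sequentially"
    using eventually_ge_at_top[of 1]
  proof eventually_elim
    case (elim i)
    have "golden_ratio powr (- 2 * real p) * golden_ratio powr (real i * p)
        = (golden_ratio powr (real i - 2)) ^ p"
      using g by (simp add: powr_power powr_add[symmetric] algebra_simps)
    also have "\<dots> \<le> real (fib i) ^ p"
      using elim(2) by (intro power_mono golden_ratio_powr_le_fib) auto
    also have "\<dots> \<le> S_F p (fib i * fib (Suc i))"
      using fib_power_le_S_F[OF elim(2), of p] by (metis of_nat_le_iff of_nat_power)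
    also have "\<dots> \<le> C * real (fib i * fib (Suc i)) powr e" by (rule elim(1))
    also have "\<dots> \<le> max 0 C * (golden_ratio powr i * golden_ratio powr (Suc i)) powr e"
      unfolding of_nat_mult using assms(2)
      by (intro mult_mono powr_mono2 fib_le_golden_ratio_powr) auto
    also have "\<dots> = (max 0 C * golden_ratio powr e) * golden_ratio powr (real i * (2 * e))"
      by (simp add: powr_powr powr_add[symmetric] algebra_simps)
    finally show ?case .
  qed
  then have "real p \<le> 2 * e"
    by (rule exponent_le_if_powr_bound[OF g, rotated]) (use g in simp)
  then show "p / 2 \<le> e" by simp
qed

theorem theorem2:
  fixes lam :: "nat \<Rightarrow> real"
  assumes "\<And>p. p \<ge> 1 \<Longrightarrow> lam p > 1"
    and "\<And>p. p \<ge> 1 \<Longrightarrow>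
           same_order (\<lambda>N. real (S_F p N)) (\<lambda>N. real N powr (ln (lam p) / ln golden_ratio))"
  shows "(\<lambda>p. lam p powr (1 / real p)) \<longlonglongrightarrow> golden_ratio powr (1 / 2)"
proof (rule tendsto_sandwich)
  note g = golden_ratio_gt_1
  \<comment> \<open>With \<open>lam p = golden_ratio powr e\<close>, the root of order
    \<open>p\<close> is \<open>golden_ratio powr (e / p)\<close>, and the moment bounds place
    \<open>e / p\<close> between \<open>1 / 2\<close> and \<open>1 / 2 + 1 / p\<close>.\<close>
  have bounds: "golden_ratio powr (1 / 2) \<le> lam p powr (1 / real p) \<and>
      lam p powr (1 / real p) \<le> golden_ratio powr (1 / 2 + 1 / real p)" if p: "p \<ge> 1" for p
  proof -
    define e where "e = ln (lam p) / ln golden_ratio"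
    have e: "e \<ge> 0" "lam p = golden_ratio powr e"
      using assms(1)[OF p] g by (simp_all add: e_def powr_def)
    have "1 / 2 \<le> e / p" "e / p \<le> 1 / 2 + 1 / p"
      using moment_exponent_bounds[OF assms(2)[OF p, folded e_def] e(1)] p
      by (simp_all add: field_simps)
    then show ?thesis using g e(2) by (simp add: powr_powr)
  qed
  show "eventually (\<lambda>p. golden_ratio powr (1 / 2) \<le> lam p powr (1 / real p)) sequentially"
    "eventually (\<lambda>p. lam p powr (1 / real p) \<le> golden_ratio powr (1 / 2 + 1 / real p)) sequentially"
    using bounds by (auto intro!: eventually_sequentiallyI[of 1])
  have "(\<lambda>p. golden_ratio powr (1 / 2 + 1 / real p)) \<longlonglongrightarrow> golden_ratio powr (1 / 2 + 0)"
    using g by (intro tendsto_intros lim_1_over_n) auto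
  then show "(\<lambda>p. golden_ratio powr (1 / 2 + 1 / real p)) \<longlonglongrightarrow> golden_ratio powr (1 / 2)"
    by simp
qed simp

end
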